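(* Let $n\geq 2$ be an integer and let $D_{\mathrm{st}}=(1,2,\dots,n)$. Let $D$ be an $n$-die whose faces sum to $\frac{n(n+1)}{2}$, and let $k,l,r$ be the non-negative integers with $k+l+r=n$ such that $D$ is of the form \[ D=(\underbrace{0,0,\dots,0}_{k\text{ zeros}},f_1,f_2,\dots,f_l,g_1,g_2,\dots,g_r), \] where $1\leq f_i\leq n$ for all $i\in\{1,\dots,l\}$ and $g_j\geq n+1$ for all $j\in\{1,\dots,r\}$. Then \[ \frac{1}{2}\Delta(D,D_{\mathrm{st}})=\left(r(n+1)-\sum_{i=1}^r g_i\right)+\frac{k-r}{2}. \]
   Context: An $n$-die is a non-decreasing sequence $D=(h_1,h_2,\dots,h_n)$ of non-negative integers (repetitions allowed); the $h_i$ are its faces. For two $n$-dice $D=(h_1,\dots,h_n)$ and $D'=(h'_1,\dots,h'_n)$ put $\gamma(D,D')=\sum_{i=1}^n \mathrm{Card}\{j\in\{1,\dots,n\} \mid h_i>h'_j\}$ and $\Delta(D,D')=\gamma(D,D')-\gamma(D',D)$. *)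

theory Defs
  imports Complex_Main
begin

text \<open>A die is the list of its faces, so the face $h_i$ is \<open>D ! (i - 1)\<close>.\<close>

definition is_die :: "nat \<Rightarrow> nat list \<Rightarrow> bool" where
  "is_die n D \<longleftrightarrow> length D = n \<and> sorted D"

text \<open>Indices run from 0 here. The functions are meant for two dice with the same
  number of faces.\<close>

definition die_gamma :: "nat list \<Rightarrow> nat list \<Rightarrow> nat" where
  "die_gamma D D' = (\<Sum>i<length D. card {j \<in> {..<length D'}. D ! i > D' ! j})"

definition die_Delta :: "nat list \<Rightarrow> nat list \<Rightarrow> int" where
  "die_Delta D D' = int (die_gamma D D') - int (die_gamma D' D)"

definition standard_die :: "nat \<Rightarrow> nat list" where
  "standard_die n = [1..<n + 1]"

end

(* A face h = 0, 1 \<le> h \<le> n or h > n contributes -n, 2h - (n+1) or n to Delta(D, D_st).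
   Summing over D, the sum of the f_i is eliminated by means of the prescribed sum of all faces. *)
theory Submission
  imports Defs
begin

text \<open>Once both values of gamma are counted along the faces of D
  (\<open>die_Delta_standard\<close>), Delta is a sum of wins minus losses of single faces. A face h
  in 1..n ties with exactly one standard face, so it wins h - 1 times and loses n - h times. Hence
  Delta = -kn + (2 F - l(n+1)) + rn, where F is the sum of the f_i, and F = n(n+1)/2 - (sum of the
  g_j). Writing n(n+1) as (k+l+r)(n+1) cancels l.\<close>

lemma length_standard_die [simp]: "length (standard_die n) = n"
  by (simp add: standard_die_def)

lemma nth_standard_die [simp]: "i < n \<Longrightarrow> standard_die n ! i = Suc i"
  by (simp add: standard_die_def del: upt_Suc)

text \<open>Index j carries the face j + 1, which h beats iff j < h - 1; truncated subtraction also
  covers h = 0.\<close>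

lemma die_gamma_standard_right:
  "die_gamma D (standard_die n) = (\<Sum>i<length D. min (D ! i - 1) n)"
  unfolding die_gamma_def
proof (rule sum.cong[OF refl])
  fix i
  have "{j \<in> {..<length (standard_die n)}. D ! i > standard_die n ! j} = {..<min (D ! i - 1) n}"
    by auto
  then show "card {j \<in> {..<length (standard_die n)}. D ! i > standard_die n ! j} = min (D ! i - 1) n"
    by simp
qed

text \<open>Double counting: the winning pairs are regrouped by the face of D that loses. Truncation
  gives 0 for faces above n.\<close>

lemma die_gamma_standard_left:
  "die_gamma (standard_die n) D = (\<Sum>j<length D. n - D ! j)"
proof -
  have "die_gamma (standard_die n) D = (\<Sum>j<length D. card {i \<in> {..<n}. standard_die n ! i > D ! j})"
    unfolding die_gamma_def length_standard_die
    by (rule sum_multicount_gen) auto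
  also have "\<dots> = (\<Sum>j<length D. n - D ! j)"
  proof (rule sum.cong[OF refl])
    fix j
    have "{i \<in> {..<n}. standard_die n ! i > D ! j} = {D ! j..<n}"
      by auto
    then show "card {i \<in> {..<n}. standard_die n ! i > D ! j} = n - D ! j"
      by simp
  qed
  finally show ?thesis .
qed

lemma die_Delta_standard:
  "die_Delta D (standard_die n) = (\<Sum>h\<leftarrow>D. int (min (h - 1) n) - int (n - h))"
  by (simp add: die_Delta_def die_gamma_standard_right die_gamma_standard_left
      sum_list_sum_nth atLeast0LessThan sum_subtractf)

theorem proposition4p1:
  fixes n k l r :: nat and D :: "nat list" and f g :: "nat \<Rightarrow> nat"
  assumes "n \<ge> 2"
    and "is_die n D"
    and "real (sum_list D) = real n * (real n + 1) / 2"
    and "k + l + r = n"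
    and "D = replicate k 0 @ map f [1..<l + 1] @ map g [1..<r + 1]"
    and "\<forall>i\<in>{1..l}. 1 \<le> f i \<and> f i \<le> n"
    and "\<forall>j\<in>{1..r}. g j \<ge> n + 1"
  shows "1 / 2 * real_of_int (die_Delta D (standard_die n)) =
    (real r * (real n + 1) - (\<Sum>i=1..r. real (g i))) + (real k - real r) / 2"
proof -
  let ?c = "\<lambda>h. int (min (h - 1) n) - int (n - h)"
  have sum_upt: "sum_list (map p [1..<m + 1]) = (\<Sum>i=1..m. p i)"
    for p :: "nat \<Rightarrow> 'a::comm_monoid_add" and m
    by (simp add: interv_sum_list_conv_sum_set_nat atLeastLessThanSuc_atLeastAtMost del: upt_Suc)
  have "die_Delta D (standard_die n) =
      - int k * int n + (\<Sum>i=1..l. ?c (f i)) + (\<Sum>i=1..r. ?c (g i))"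
    unfolding die_Delta_standard assms(5)
    using sum_upt[of "\<lambda>i. ?c (f i)" l] sum_upt[of "\<lambda>i. ?c (g i)" r]
    by (simp add: sum_list_replicate o_def del: upt_Suc)
  \<comment> \<open>For 1 \<le> h \<le> n neither subtraction truncates and the cap n is not
    reached.\<close>
  also have "(\<Sum>i=1..l. ?c (f i)) = (\<Sum>i=1..l. 2 * int (f i) - (int n + 1))"
    using assms(6) by (intro sum.cong refl) (fastforce simp: min_def)
  also have "\<dots> = 2 * (\<Sum>i=1..l. int (f i)) - int l * (int n + 1)"
    by (simp add: sum_subtractf sum_distrib_left)
  also have "(\<Sum>i=1..r. ?c (g i)) = (\<Sum>i=1..r. int n)"
    using assms(7) by (intro sum.cong refl) (fastforce simp: min_def)
  also have "\<dots> = int r * int n"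
    by simp
  finally have "real_of_int (die_Delta D (standard_die n)) =
      - real k * real n + (2 * (\<Sum>i=1..l. real (f i)) - real l * (real n + 1)) + real r * real n"
    by simp
  moreover have "(\<Sum>i=1..l. real (f i)) + (\<Sum>i=1..r. real (g i)) = real n * (real n + 1) / 2"
    using assms(3) sum_upt[of f l] sum_upt[of g r]
    by (simp add: assms(5) sum_list_replicate del: upt_Suc)
  \<comment> \<open>Only one factor n is expanded, so the l(n+1) of the middle faces cancels as a
    whole.\<close>
  moreover have "real n * (real n + 1) = (real k + real l + real r) * (real n + 1)"
    using assms(4) by auto
  ultimately show ?thesis
    by (simp add: field_simps)
qed

end
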